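(* Let $X$ be a locally solid $f$-ring that possesses the $AM$-property and the Levi property, and let $Y$ be an order complete locally solid $f$-ring. If $Y$ has the Lebesgue property, then $\mathsf{Hom}^{b}(X,Y)$ has the Lebesgue property.
   Context: An $\ell$-ring (lattice ring) is a ring which is also a lattice, the additive group being a lattice-ordered group, with $|x\cdot y|\le |x|\cdot|y|$ for all $x,y$. $X_+=\{x\in X: x\ge 0\}$. A set $S\subseteq X$ is solid if $x\in X$, $y\in S$, $|x|\le|y|$ imply $x\in S$. A locally solid $\ell$-ring is an $\ell$-ring that is also a topological ring and has a local basis at zero consisting of solid sets. An $f$-ring is an $\ell$-ring in which $a\wedge b=0$ and $c>0$ imply $ca\wedge b=ac\wedge b=0$; a locally solid $f$-ring is a locally solid $\ell$-ring that is an $f$-ring. Order complete: every non-empty subset that is bounded above has a supremum. Archimedean: $nx\le y$ for all $n\in\mathbb N$ implies $x\le 0$. A set $B$ in a topological ring is bounded if for each zero neighborhood $W$ there is a zero neighborhood $V$ with $VB\subseteq W$ and $BV\subseteq W$ (sets of products). For $B\subseteq X$, $B^{\vee}=\{b_1\vee\dots\vee b_n: n\in\mathbb N,\ b_i\in B\}$. An Archimedean locally solid $\ell$-ring has the $AM$-property if $B^{\vee}$ is bounded for every bounded set $B$. A locally solid $\ell$-ring has the Levi property if every bounded upward directed set of positive elements has a supremum. The Lebesgue property (of a space with a group topology and a lattice order as here): every net with $u_\alpha\downarrow 0$ converges to $0$ topologically. $\mathsf{Hom}^{b}(X,Y)$ is the set of all order bounded group homomorphisms $T:X\to Y$ (additive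 maps sending order bounded sets, i.e. sets contained in an order interval $[u,v]$, to order bounded sets), with pointwise addition, ordered by $T\le S$ iff $T(x)\le S(x)$ for all $x\in X_+$ (lattice operations given by Riesz–Kantorovich formulae, in particular $|T|(x)=\sup\{|T(u)|:|u|\le x\}$ for $x\in X_+$). Under the hypotheses here every element of $\mathsf{Hom}^{b}(X,Y)$ is $br$-bounded (maps bounded sets to bounded sets), so $\mathsf{Hom}^{b}(X,Y)=\mathsf{Hom}^{b}_{br}(X,Y)$, and it carries the topology of uniform convergence on bounded sets: $S_\alpha\to S$ iff for each bounded $B\subseteq X$ and each zero neighborhood $V\subseteq Y$ there is $\alpha_0$ with $(S_\alpha-S)(B)\subseteq V$ for all $\alpha\ge\alpha_0$. Standing assumption: in every topological group considered (including the additive groups of topological rings), singletons are bounded in the group sense: for each $x$ and each neighborhood $U$ of the identity there is a positive integer $n$ with $x\in nU=\{x_1+\dots+x_n: x_i\in U\}$. *)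

theory Defs
  imports "HOL-Analysis.Analysis" "HOL-Library.Lattice_Algebras"
begin

definition (in lattice_ab_group_add_abs) solid :: "'a set \<Rightarrow> bool" where
  "solid S \<longleftrightarrow> (\<forall>x. \<forall>y\<in>S. \<bar>x\<bar> \<le> \<bar>y\<bar> \<longrightarrow> x \<in> S)"

text \<open>
  The class \<open>lattice_ring\<close> requires left and right multiplication by positive elements to be
  monotone. For a ring whose additive group is lattice-ordered this is equivalent to
  \<open>\<bar>x * y\<bar> \<le> \<bar>x\<bar> * \<bar>y\<bar>\<close>: one direction is \<open>abs_le_mult\<close>, the other one is the next lemma.
  Rings are associative, not necessarily unital or commutative, and the topology is not
  required to be Hausdorff.
\<close>

lemma mult_left_right_mono_if_abs_mult_le:
  fixes a b c :: "'a :: {ring, lattice_ab_group_add_abs}"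
  assumes abs_mult: "\<And>x y :: 'a. \<bar>x * y\<bar> \<le> \<bar>x\<bar> * \<bar>y\<bar>" and "a \<le> b" and "0 \<le> c"
  shows "c * a \<le> c * b" and "a * c \<le> b * c"
proof -
  have pos: "0 \<le> x * y" if "0 \<le> x" "0 \<le> y" for x y :: 'a
    using abs_mult[of x y] that by (metis abs_ge_zero abs_of_nonneg order_trans)
  show "c * a \<le> c * b"
    using pos[of c "b - a"] assms(2,3) by (simp add: right_diff_distrib)
  show "a * c \<le> b * c"
    using pos[of "b - a" c] assms(2,3) by (simp add: left_diff_distrib)
qed

class locally_solid_l_ring =
  lattice_ring + topological_ab_group_add + topological_semigroup_mult +
  assumes locally_solid:
    "open U \<Longrightarrow> 0 \<in> U \<Longrightarrow> \<exists>S\<subseteq>U. solid S \<and> (\<exists>V\<subseteq>S. open V \<and> 0 \<in> V)"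

class locally_solid_f_ring = locally_solid_l_ring +
  assumes f_ring:
    "inf a b = 0 \<Longrightarrow> 0 < c \<Longrightarrow> inf (c * a) b = 0 \<and> inf (a * c) b = 0"

definition zero_nbhd :: "'a :: {zero, topological_space} set \<Rightarrow> bool" where
  "zero_nbhd U \<longleftrightarrow> 0 \<in> interior U"

text \<open>
  Boundedness of singletons in the sense of topological groups: every \<open>x\<close> lies in some
  \<open>n\<close>-fold sum \<open>U + \<dots> + U\<close>.
\<close>

definition singletons_group_bounded :: "'a :: topological_ab_group_add itself \<Rightarrow> bool" where
  "singletons_group_bounded _ \<longleftrightarrow>
     (\<forall>(x :: 'a) U. zero_nbhd U \<longrightarrow>
        (\<exists>n f. n > 0 \<and> (\<forall>i<n. f i \<in> U) \<and> x = (\<Sum>i<(n::nat). f i)))"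

definition ring_bounded :: "'a :: {ring, topological_space} set \<Rightarrow> bool" where
  "ring_bounded B \<longleftrightarrow>
     (\<forall>W. zero_nbhd W \<longrightarrow>
        (\<exists>V. zero_nbhd V \<and> (\<forall>v\<in>V. \<forall>b\<in>B. v * b \<in> W \<and> b * v \<in> W)))"

text \<open>The multiple \<open>n x\<close> is written as a sum because the ring need not have a unit.\<close>

definition archimedean :: "'a :: lattice_ab_group_add itself \<Rightarrow> bool" where
  "archimedean _ \<longleftrightarrow>
     (\<forall>x y :: 'a. (\<forall>n::nat. n \<ge> 1 \<longrightarrow> (\<Sum>i<n. x) \<le> y) \<longrightarrow> x \<le> 0)"

definition finite_sups :: "'a :: lattice set \<Rightarrow> 'a set" where
  "finite_sups B = {Sup_fin F | F. F \<subseteq> B \<and> finite F \<and> F \<noteq> {}}"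

definition AM_property :: "'a :: locally_solid_l_ring itself \<Rightarrow> bool" where
  "AM_property _ \<longleftrightarrow>
     archimedean TYPE('a) \<and>
     (\<forall>B :: 'a set. ring_bounded B \<longrightarrow> ring_bounded (finite_sups B))"

definition Levi_property :: "'a :: locally_solid_l_ring itself \<Rightarrow> bool" where
  "Levi_property _ \<longleftrightarrow>
     (\<forall>D :: 'a set.
        D \<noteq> {} \<and> (\<forall>x\<in>D. \<forall>y\<in>D. \<exists>z\<in>D. x \<le> z \<and> y \<le> z) \<and> (\<forall>x\<in>D. 0 \<le> x) \<and> ring_bounded D \<longrightarrow>
        (\<exists>s. (\<forall>x\<in>D. x \<le> s) \<and> (\<forall>t. (\<forall>x\<in>D. x \<le> t) \<longrightarrow> s \<le> t)))"

definition directed_index :: "'i set \<Rightarrow> ('i \<Rightarrow> 'i \<Rightarrow> bool) \<Rightarrow> bool" where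
  "directed_index I r \<longleftrightarrow>
     I \<noteq> {} \<and> reflp_on I r \<and> transp_on I r \<and> (\<forall>i\<in>I. \<forall>j\<in>I. \<exists>k\<in>I. r i k \<and> r j k)"

definition net_filter :: "'i set \<Rightarrow> ('i \<Rightarrow> 'i \<Rightarrow> bool) \<Rightarrow> 'i filter" where
  "net_filter I r = (INF i\<in>I. principal {j\<in>I. r i j})"

lemma eventually_net_filter:
  assumes "directed_index I r"
  shows "eventually P (net_filter I r) \<longleftrightarrow> (\<exists>i\<in>I. \<forall>j\<in>I. r i j \<longrightarrow> P j)"
  unfolding net_filter_def
proof (subst eventually_INF_base)
  show "I \<noteq> {}" using assms by (simp add: directed_index_def)
  fix a b assume ab: "a \<in> I" "b \<in> I"
  then obtain k where k: "k \<in> I" "r a k" "r b k"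
    using assms unfolding directed_index_def by blast
  have "r a j \<and> r b j" if "j \<in> I" "r k j" for j
    using assms ab k that unfolding directed_index_def by (meson transp_onD)
  with k show "\<exists>x\<in>I. principal {j \<in> I. r x j}
      \<le> inf (principal {j \<in> I. r a j}) (principal {j \<in> I. r b j})"
    by auto
qed (auto simp: eventually_principal)

text \<open>
  \<open>u \<down> z\<close> for a net \<open>u\<close> in the set \<open>C\<close> preordered by \<open>le\<close>; the infimum is taken in \<open>C\<close>.
\<close>

definition net_decreases_to ::
    "'c set \<Rightarrow> ('c \<Rightarrow> 'c \<Rightarrow> bool) \<Rightarrow> 'i set \<Rightarrow> ('i \<Rightarrow> 'i \<Rightarrow> bool) \<Rightarrow> ('i \<Rightarrow> 'c) \<Rightarrow> 'c \<Rightarrow> bool" where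
  "net_decreases_to C le I r u z \<longleftrightarrow>
     u ` I \<subseteq> C \<and> (\<forall>i\<in>I. \<forall>j\<in>I. r i j \<longrightarrow> le (u j) (u i)) \<and>
     z \<in> C \<and> (\<forall>i\<in>I. le z (u i)) \<and> (\<forall>w\<in>C. (\<forall>i\<in>I. le w (u i)) \<longrightarrow> le w z)"

text \<open>
  The property is relative to the type \<open>'i\<close> of net indices, because one cannot quantify over
  types. By the lemma below, the property for nets indexed by subsets of the space itself
  implies the property for every index type.
\<close>

definition Lebesgue_property ::
    "'i itself \<Rightarrow> 'c topology \<Rightarrow> ('c \<Rightarrow> 'c \<Rightarrow> bool) \<Rightarrow> 'c \<Rightarrow> bool" where
  "Lebesgue_property _ X le z \<longleftrightarrow>
     (\<forall>(I :: 'i set) r u.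
        directed_index I r \<and> net_decreases_to (topspace X) le I r u z \<longrightarrow>
        limitin X u z (net_filter I r))"

lemma Lebesgue_property_any_index:
  fixes X :: "'c topology"
  assumes L: "Lebesgue_property TYPE('c) X le z"
    and refl: "reflp_on (topspace X) le" and trans: "transp_on (topspace X) le"
  shows "Lebesgue_property TYPE('i) X le z"
  unfolding Lebesgue_property_def
proof (intro allI impI)
  fix I :: "'i set" and r u
  assume a: "directed_index I r \<and> net_decreases_to (topspace X) le I r u z"
  define J where "J = u ` I"
  define s where "s = (\<lambda>d e. le e d)"
  have JX: "J \<subseteq> topspace X" using a unfolding J_def net_decreases_to_def by blast
  have dir: "directed_index J s"
    unfolding directed_index_def
  proof (intro conjI ballI)
    show "J \<noteq> {}" using a unfolding J_def directed_index_def by blast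
    show "reflp_on J s" using refl JX unfolding s_def by (auto simp: reflp_on_def)
    show "transp_on J s" using trans JX unfolding s_def transp_on_def by blast
    fix d e assume "d \<in> J" "e \<in> J"
    then obtain i j where ij: "i \<in> I" "j \<in> I" "d = u i" "e = u j" unfolding J_def by blast
    then obtain k where "k \<in> I" "r i k" "r j k" using a unfolding directed_index_def by blast
    then show "\<exists>k\<in>J. s d k \<and> s e k"
      using a ij unfolding J_def s_def net_decreases_to_def by blast
  qed
  have "net_decreases_to (topspace X) le J s id z"
    using a JX unfolding J_def s_def net_decreases_to_def by auto
  with L dir have lim: "limitin X id z (net_filter J s)"
    unfolding Lebesgue_property_def by blast
  show "limitin X u z (net_filter I r)"
    unfolding limitin_def
  proof (intro conjI allI impI)
    show "z \<in> topspace X" using lim by (simp add: limitin_def)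
    fix U assume "openin X U \<and> z \<in> U"
    with lim obtain d where d: "d \<in> J" "\<forall>e\<in>J. s d e \<longrightarrow> e \<in> U"
      unfolding limitin_def eventually_net_filter[OF dir] by auto
    then obtain i where i: "i \<in> I" "d = u i" unfolding J_def by blast
    have "u j \<in> U" if "j \<in> I" "r i j" for j
    proof -
      have "le (u j) (u i)" using a i(1) that by (simp add: net_decreases_to_def)
      then show ?thesis using d(2) i(2) that(1) by (simp add: J_def s_def)
    qed
    with i show "eventually (\<lambda>j. u j \<in> U) (net_filter I r)"
      using a by (auto simp: eventually_net_filter)
  qed
qed

definition order_bounded :: "'a :: order set \<Rightarrow> bool" where
  "order_bounded A \<longleftrightarrow> (\<exists>u v. A \<subseteq> {u..v})"

definition Hom_b ::
    "('a :: locally_solid_l_ring \<Rightarrow> 'b :: locally_solid_l_ring) set" where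
  "Hom_b = {T. Modules.additive T \<and> (\<forall>A. order_bounded A \<longrightarrow> order_bounded (T ` A))}"

definition hom_le ::
    "('a :: locally_solid_l_ring \<Rightarrow> 'b :: locally_solid_l_ring) \<Rightarrow> ('a \<Rightarrow> 'b) \<Rightarrow> bool" where
  "hom_le T S \<longleftrightarrow> (\<forall>x\<ge>0. T x \<le> S x)"

text \<open>
  The basic neighbourhoods of \<open>S\<close> are the sets of all \<open>T\<close> with \<open>(T - S) B \<subseteq> V\<close>, for bounded
  \<open>B\<close> and zero neighbourhoods \<open>V\<close>.
\<close>

definition hom_open ::
    "('a :: locally_solid_l_ring \<Rightarrow> 'b :: locally_solid_l_ring) set \<Rightarrow> bool" where
  "hom_open U \<longleftrightarrow>
     U \<subseteq> Hom_b \<and>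
     (\<forall>S\<in>U. \<exists>B V. ring_bounded B \<and> zero_nbhd V \<and> {T\<in>Hom_b. \<forall>x\<in>B. T x - S x \<in> V} \<subseteq> U)"

definition hom_topology ::
    "('a :: locally_solid_l_ring \<Rightarrow> 'b :: locally_solid_l_ring) topology" where
  "hom_topology = topology hom_open"

lemma zero_nbhd_Int: "zero_nbhd U \<Longrightarrow> zero_nbhd V \<Longrightarrow> zero_nbhd (U \<inter> V)"
  by (simp add: zero_nbhd_def)

lemma zero_nbhd_UNIV [simp]: "zero_nbhd UNIV"
  by (simp add: zero_nbhd_def)

lemma zero_nbhd_half:
  fixes W :: "'a :: topological_monoid_add set"
  assumes "zero_nbhd W"
  obtains V where "zero_nbhd V" "\<And>x y. x \<in> V \<Longrightarrow> y \<in> V \<Longrightarrow> x + y \<in> W"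
proof -
  have "((\<lambda>p. fst p + snd p) \<longlongrightarrow> (0::'a) + 0) (nhds 0 \<times>\<^sub>F nhds 0)"
    by (rule tendsto_add_Pair)
  moreover have "open (interior W)" "0 + 0 \<in> interior W"
    using assms by (auto simp: zero_nbhd_def)
  ultimately have "eventually (\<lambda>p. fst p + snd p \<in> interior W) (nhds 0 \<times>\<^sub>F nhds 0)"
    by (rule topological_tendstoD)
  then obtain P Q where PQ: "eventually P (nhds (0::'a))" "eventually Q (nhds (0::'a))"
    "\<And>x y. P x \<Longrightarrow> Q y \<Longrightarrow> x + y \<in> interior W"
    unfolding eventually_prod_filter by auto
  have "eventually (\<lambda>x. P x \<and> Q x) (nhds 0)" using PQ by (simp add: eventually_conj)
  then have "zero_nbhd {x. P x \<and> Q x}"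
    unfolding zero_nbhd_def by (auto simp: eventually_nhds interior_def)
  moreover have "x + y \<in> W" if "x \<in> {x. P x \<and> Q x}" "y \<in> {x. P x \<and> Q x}" for x y
    using PQ(3) that interior_subset by blast
  ultimately show ?thesis using that by blast
qed

lemma ring_bounded_empty: "ring_bounded {}"
  unfolding ring_bounded_def by (intro allI impI exI[of _ UNIV]) simp

lemma ring_bounded_Un:
  assumes "ring_bounded A" "ring_bounded B"
  shows "ring_bounded (A \<union> B)"
  unfolding ring_bounded_def
proof (intro allI impI)
  fix W :: "'a set" assume W: "zero_nbhd W"
  obtain V where V: "zero_nbhd V" "\<forall>v\<in>V. \<forall>b\<in>A. v * b \<in> W \<and> b * v \<in> W"
    using assms(1)[unfolded ring_bounded_def, rule_format, OF W] by (elim exE conjE)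
  obtain V' where V': "zero_nbhd V'" "\<forall>v\<in>V'. \<forall>b\<in>B. v * b \<in> W \<and> b * v \<in> W"
    using assms(2)[unfolded ring_bounded_def, rule_format, OF W] by (elim exE conjE)
  show "\<exists>V. zero_nbhd V \<and> (\<forall>v\<in>V. \<forall>b\<in>A \<union> B. v * b \<in> W \<and> b * v \<in> W)"
    using V V' by (intro exI[of _ "V \<inter> V'"]) (auto intro: zero_nbhd_Int)
qed

lemma istopology_hom_open: "istopology hom_open"
  unfolding istopology_def
proof (intro conjI allI impI)
  fix S T :: "('a \<Rightarrow> 'b) set"
  assume S: "hom_open S" and T: "hom_open T"
  show "hom_open (S \<inter> T)"
    unfolding hom_open_def
  proof (intro conjI ballI)
    show "S \<inter> T \<subseteq> Hom_b" using S by (auto simp: hom_open_def)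
    fix R assume "R \<in> S \<inter> T"
    then have R: "R \<in> S" "R \<in> T" by auto
    from S R(1) obtain B V where
      "ring_bounded B" "zero_nbhd V" "{T\<in>Hom_b. \<forall>x\<in>B. T x - R x \<in> V} \<subseteq> S"
      unfolding hom_open_def by meson
    moreover from T R(2) obtain B' V' where
      "ring_bounded B'" "zero_nbhd V'" "{T\<in>Hom_b. \<forall>x\<in>B'. T x - R x \<in> V'} \<subseteq> T"
      unfolding hom_open_def by meson
    ultimately show "\<exists>B V. ring_bounded B \<and> zero_nbhd V \<and>
        {Ta \<in> Hom_b. \<forall>x\<in>B. Ta x - R x \<in> V} \<subseteq> S \<inter> T"
      by (intro exI[of _ "B \<union> B'"] exI[of _ "V \<inter> V'"])
        (auto intro: ring_bounded_Un zero_nbhd_Int)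
  qed
next
  fix K :: "('a \<Rightarrow> 'b) set set"
  assume K: "\<forall>S\<in>K. hom_open S"
  show "hom_open (\<Union>K)"
    unfolding hom_open_def
  proof (intro conjI ballI)
    show "\<Union>K \<subseteq> Hom_b" using K by (auto simp: hom_open_def)
    fix R assume "R \<in> \<Union>K"
    then obtain S where S: "S \<in> K" "R \<in> S" by blast
    with K obtain B V where
      "ring_bounded B" "zero_nbhd V" "{T\<in>Hom_b. \<forall>x\<in>B. T x - R x \<in> V} \<subseteq> S"
      unfolding hom_open_def by meson
    with S show "\<exists>B V. ring_bounded B \<and> zero_nbhd V \<and>
        {T \<in> Hom_b. \<forall>x\<in>B. T x - R x \<in> V} \<subseteq> \<Union>K"
      by (intro exI[of _ B] exI[of _ V]) auto
  qed
qed

lemma openin_hom_topology: "openin hom_topology = hom_open"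
  by (simp add: hom_topology_def istopology_hom_open)

lemma topspace_hom_topology: "topspace hom_topology = Hom_b"
proof (rule antisym)
  show "topspace hom_topology \<subseteq> Hom_b"
    by (auto simp: topspace_def openin_hom_topology hom_open_def)
  have "hom_open Hom_b"
    unfolding hom_open_def
  proof (intro conjI ballI exI)
    show "ring_bounded {}" by (rule ring_bounded_empty)
    show "zero_nbhd UNIV" by (rule zero_nbhd_UNIV)
  qed auto
  then show "Hom_b \<subseteq> topspace hom_topology"
    by (intro openin_subset) (simp add: openin_hom_topology)
qed

text \<open>Convergence in this topology is uniform convergence on bounded sets.\<close>

lemma limitin_hom_topology:
  fixes S :: "'a :: locally_solid_l_ring \<Rightarrow> 'b :: locally_solid_l_ring"
  shows
  "limitin hom_topology u S F \<longleftrightarrow>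
     S \<in> Hom_b \<and>
     (\<forall>B V. ring_bounded B \<and> zero_nbhd V \<longrightarrow>
        eventually (\<lambda>i. u i \<in> Hom_b \<and> (\<forall>x\<in>B. u i x - S x \<in> V)) F)"
  (is "?L \<longleftrightarrow> ?R")
proof
  assume ?R
  show ?L
    unfolding limitin_def topspace_hom_topology openin_hom_topology
  proof (intro conjI allI impI)
    show "S \<in> Hom_b" using \<open>?R\<close> by blast
    fix U assume "hom_open U \<and> S \<in> U"
    then obtain B V where BV: "ring_bounded B" "zero_nbhd V"
        "{T\<in>Hom_b. \<forall>x\<in>B. T x - S x \<in> V} \<subseteq> U"
      unfolding hom_open_def by meson
    with \<open>?R\<close> have "eventually (\<lambda>i. u i \<in> Hom_b \<and> (\<forall>x\<in>B. u i x - S x \<in> V)) F" by blast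
    then show "eventually (\<lambda>i. u i \<in> U) F"
      by (rule eventually_mono) (use BV in auto)
  qed
next
  assume ?L
  then have S: "S \<in> Hom_b" by (simp add: limitin_def topspace_hom_topology)
  show ?R
  proof (intro conjI allI impI)
    show "S \<in> Hom_b" by fact
    fix B :: "'a set" and V :: "'b set"
    assume BV: "ring_bounded B \<and> zero_nbhd V"
    define N where "N = (\<lambda>R W. {T\<in>Hom_b. \<forall>x\<in>B. T x - R x \<in> (W :: 'b set)})"
    define U where "U = {R\<in>Hom_b. \<exists>W. zero_nbhd W \<and> N R W \<subseteq> N S V}"
    have "hom_open U"
      unfolding hom_open_def
    proof (intro conjI ballI)
      show "U \<subseteq> Hom_b" by (auto simp: U_def)
      fix R assume "R \<in> U"
      then obtain W where W: "zero_nbhd W" "N R W \<subseteq> N S V" by (auto simp: U_def)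
      from zero_nbhd_half[OF W(1)] obtain W' where W': "zero_nbhd W'"
        "\<And>x y. x \<in> W' \<Longrightarrow> y \<in> W' \<Longrightarrow> x + y \<in> W" by blast
      have "N Q W' \<subseteq> N R W" if "Q \<in> N R W'" for Q
      proof
        fix T assume T: "T \<in> N Q W'"
        have "T x - R x \<in> W" if "x \<in> B" for x
          using W'(2)[of "T x - Q x" "Q x - R x"] T \<open>Q \<in> N R W'\<close> that by (simp add: N_def)
        then show "T \<in> N R W" using T by (simp add: N_def)
      qed
      then have sub: "N Q W' \<subseteq> N S V" if "Q \<in> N R W'" for Q
        using that W(2) by (meson order_trans)
      have "N R W' \<subseteq> U"
      proof
        fix Q assume Q: "Q \<in> N R W'"
        then have "Q \<in> Hom_b" by (simp add: N_def)
        then show "Q \<in> U" using sub[OF Q] W'(1) unfolding U_def by blast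
      qed
      then show "\<exists>B V. ring_bounded B \<and> zero_nbhd V \<and>
          {T \<in> Hom_b. \<forall>x\<in>B. T x - R x \<in> V} \<subseteq> U"
        using BV W'(1) unfolding N_def by (intro exI[of _ B] exI[of _ W'] conjI) auto
    qed
    moreover have "S \<in> U" using S BV by (auto simp: U_def)
    ultimately have "eventually (\<lambda>i. u i \<in> U) F"
      using \<open>?L\<close> by (simp add: limitin_def openin_hom_topology)
    moreover have "R \<in> N S V" if R: "R \<in> U" for R
    proof -
      from R obtain W where W: "R \<in> Hom_b" "zero_nbhd W" "N R W \<subseteq> N S V"
        by (auto simp: U_def)
      have "0 \<in> W" using W(2) interior_subset unfolding zero_nbhd_def by blast
      then show ?thesis using W by (auto simp: N_def)
    qed
    ultimately have "eventually (\<lambda>i. u i \<in> N S V) F"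
      by (rule eventually_mono)
    then show "eventually (\<lambda>i. u i \<in> Hom_b \<and> (\<forall>x\<in>B. u i x - S x \<in> V)) F"
      by (simp add: N_def)
  qed
qed

end

theory Submission
  imports Defs
begin

text \<open>
  A ring bounded set \<open>B\<close> of \<open>X\<close> is order bounded. Multiplication by a positive element of an
  \<open>f\<close>-ring preserves disjointness, so it commutes with the absolute value, and therefore the
  set of all \<open>\<bar>b\<bar>\<close> with \<open>b \<in> B\<close> is again ring bounded. By the AM-property its finite suprema
  form a ring bounded set, which is directed and positive, so the Levi property provides an
  upper bound \<open>s\<close> of all \<open>\<bar>b\<bar>\<close> (\<open>ring_bounded_imp_abs_bounded\<close>).

  Let now \<open>u\<^sub>i \<down> 0\<close> in \<open>Hom\<^sup>b(X,Y)\<close>. The \<open>u\<^sub>i\<close> are positive, so \<open>\<bar>u\<^sub>i b\<bar> \<le> u\<^sub>i s\<close> for all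
  \<open>b \<in> B\<close>. As the topology of \<open>Y\<close> is locally solid, uniform convergence on \<open>B\<close> follows from the
  convergence of the single net \<open>u\<^sub>i s\<close>.

  The Lebesgue property of \<open>Y\<close> applies to that net once its infimum in \<open>Y\<close> is known to be \<open>0\<close>,
  whereas the hypothesis speaks of an infimum among homomorphisms. The two agree because \<open>Y\<close> is
  order complete: the pointwise infimum \<open>x \<mapsto> inf\<^sub>i u\<^sub>i x\<close> on the positive cone is additive, as
  the net is decreasing, and extends to a positive homomorphism. That homomorphism is a lower
  bound of the \<open>u\<^sub>i\<close>, so it is \<open>0\<close> (\<open>net_decreases_to_0_pointwise\<close>).
\<close>

section \<open>Additive maps on lattice-ordered groups\<close>

lemma additive_pos_mono:
  fixes T :: "'a :: ordered_ab_group_add \<Rightarrow> 'b :: ordered_ab_group_add"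
  assumes "Modules.additive T" and "\<And>x. 0 \<le> x \<Longrightarrow> 0 \<le> T x" and "x \<le> y"
  shows "T x \<le> T y"
  using assms(2)[of "y - x"] assms(3) by (simp add: additive.diff[OF assms(1)])

lemma additive_pos_abs_le:
  fixes T :: "'a :: lattice_ab_group_add_abs \<Rightarrow> 'b :: lattice_ab_group_add_abs"
  assumes T: "Modules.additive T" "\<And>x. 0 \<le> x \<Longrightarrow> 0 \<le> T x" and "\<bar>x\<bar> \<le> s"
  shows "\<bar>T x\<bar> \<le> T s"
proof (rule abs_leI)
  have "x \<le> s" "- x \<le> s"
    using assms(3) abs_ge_self[of x] abs_ge_minus_self[of x] by (auto intro: order_trans)
  then show "T x \<le> T s" "- T x \<le> T s"
    using additive_pos_mono[OF T, of x s] additive_pos_mono[OF T, of "- x" s]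
    by (simp_all add: additive.minus[OF T(1)])
qed

lemma additive_pos_in_Hom_b:
  assumes "Modules.additive T" and "\<And>x. 0 \<le> x \<Longrightarrow> 0 \<le> T x"
  shows "T \<in> Hom_b"
proof -
  have "T ` A \<subseteq> {T a..T b}" if "A \<subseteq> {a..b}" for A a b
    using that additive_pos_mono[OF assms] by fastforce
  then show ?thesis
    using assms(1) unfolding Hom_b_def order_bounded_def by blast
qed

text \<open>
  The identity \<open>(x + y)\<^sup>+ + x\<^sup>- + y\<^sup>- = (x + y)\<^sup>- + x\<^sup>+ + y\<^sup>+\<close> relates only positive elements, so
  \<open>f\<close> can be applied to it; this makes \<open>f(x\<^sup>+) - f(x\<^sup>-)\<close> additive.
\<close>

lemma additive_extend_pos_cone:
  fixes f :: "'a :: lattice_ab_group_add \<Rightarrow> 'b :: ab_group_add"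
  assumes f_add: "\<And>x y. 0 \<le> x \<Longrightarrow> 0 \<le> y \<Longrightarrow> f (x + y) = f x + f y"
  obtains T where "Modules.additive T" and "\<And>x. 0 \<le> x \<Longrightarrow> T x = f x"
proof
  define T where "T = (\<lambda>x. f (pprt x) - f (- nprt x))"
  have f_add3: "f (x + (y + z)) = f x + (f y + f z)" if "0 \<le> x" "0 \<le> y" "0 \<le> z" for x y z
    using that by (simp add: f_add)
  have f0: "f 0 = 0" using f_add[of 0 0] by simp
  show "T x = f x" if "0 \<le> x" for x
    using that by (simp add: T_def f0)
  show "Modules.additive T"
  proof
    fix x y :: 'a
    have eq: "pprt (x + y) + (- nprt x + - nprt y) = - nprt (x + y) + (pprt x + pprt y)"
      using prts[of x] prts[of y] prts[of "x + y"] by (simp add: algebra_simps)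
    have "f (pprt (x + y)) + (f (- nprt x) + f (- nprt y))
        = f (pprt (x + y) + (- nprt x + - nprt y))"
      by (rule f_add3[symmetric]) simp_all
    also have "\<dots> = f (- nprt (x + y)) + (f (pprt x) + f (pprt y))"
      unfolding eq by (rule f_add3) simp_all
    finally show "T (x + y) = T x + T y"
      unfolding T_def by (simp add: algebra_simps)
  qed
qed

text \<open>
  \<open>F\<close> is only directed downwards, so an upper estimate of the infimum at \<open>x + y\<close> by
  \<open>g x + h y\<close> has to pass through a common lower bound of \<open>g\<close> and \<open>h\<close> in \<open>F\<close>.
\<close>

lemma cINF_add_directed:
  fixes F :: "('a :: ordered_ab_group_add
    \<Rightarrow> 'b :: {ordered_ab_group_add, conditionally_complete_lattice}) set"
  assumes ne: "F \<noteq> {}"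
    and add: "\<And>g. g \<in> F \<Longrightarrow> Modules.additive g"
    and pos: "\<And>g x. g \<in> F \<Longrightarrow> 0 \<le> x \<Longrightarrow> 0 \<le> g x"
    and dir: "\<And>g h. g \<in> F \<Longrightarrow> h \<in> F \<Longrightarrow> \<exists>k\<in>F. \<forall>x\<ge>0. k x \<le> g x \<and> k x \<le> h x"
    and x: "0 \<le> x" and y: "0 \<le> y"
  shows "(INF g\<in>F. g (x + y)) = (INF g\<in>F. g x) + (INF g\<in>F. g y)"
proof (rule antisym)
  have lower: "(INF g\<in>F. g z) \<le> h z" if "0 \<le> z" "h \<in> F" for z h
    using that pos by (intro cINF_lower bdd_belowI[of _ 0]) auto
  show "(INF g\<in>F. g x) + (INF g\<in>F. g y) \<le> (INF g\<in>F. g (x + y))"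
    using ne lower[OF x] lower[OF y]
    by (intro cINF_greatest) (auto simp: additive.add[OF add] intro: add_mono)
  have two: "(INF g\<in>F. g (x + y)) \<le> g x + h y" if gh: "g \<in> F" "h \<in> F" for g h
  proof -
    obtain k where k: "k \<in> F" "k x \<le> g x" "k y \<le> h y"
      using dir[OF gh] x y by blast
    have "(INF g\<in>F. g (x + y)) \<le> k (x + y)"
      using lower[of "x + y"] k(1) x y by simp
    also have "\<dots> \<le> g x + h y"
      using k by (simp add: additive.add[OF add] add_mono)
    finally show ?thesis .
  qed
  have "(INF g\<in>F. g (x + y)) - h y \<le> (INF g\<in>F. g x)" if "h \<in> F" for h
    using two[OF _ that] ne by (intro cINF_greatest) (auto simp: algebra_simps)
  then have "(INF g\<in>F. g (x + y)) - (INF g\<in>F. g x) \<le> (INF g\<in>F. g y)"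
    using ne by (intro cINF_greatest) (auto simp: algebra_simps)
  then show "(INF g\<in>F. g (x + y)) \<le> (INF g\<in>F. g x) + (INF g\<in>F. g y)"
    by (simp add: algebra_simps)
qed

section \<open>Infima of homomorphisms\<close>

text \<open>
  A lower bound of the values at the single point \<open>s\<close> does not by itself give a homomorphism
  below the net. The greatest one does: it is the value at \<open>s\<close> of the pointwise infimum, which
  is a positive homomorphism and so is at most \<open>0\<close>, being below every \<open>u i\<close>.
\<close>

lemma net_decreases_to_0_pointwise:
  fixes u :: "'i \<Rightarrow> 'a :: locally_solid_l_ring
    \<Rightarrow> 'b :: {locally_solid_l_ring, conditionally_complete_lattice}"
  assumes I: "directed_index I r"
    and u: "net_decreases_to Hom_b hom_le I r u (\<lambda>_. 0)"
    and s: "0 \<le> s"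
  shows "net_decreases_to UNIV (\<le>) I r (\<lambda>i. u i s) 0"
proof -
  have ne: "u ` I \<noteq> {}" using I by (simp add: directed_index_def)
  have add: "Modules.additive g" if "g \<in> u ` I" for g
    using u that by (auto simp: net_decreases_to_def Hom_b_def)
  have pos: "0 \<le> g x" if "g \<in> u ` I" "0 \<le> x" for g x
    using u that by (auto simp: net_decreases_to_def hom_le_def)
  have dir: "\<exists>k\<in>u ` I. \<forall>x\<ge>0. k x \<le> g x \<and> k x \<le> h x" if gh: "g \<in> u ` I" "h \<in> u ` I" for g h
  proof -
    from gh obtain i j where ij: "i \<in> I" "j \<in> I" "g = u i" "h = u j" by blast
    then obtain k where "k \<in> I" "r i k" "r j k" using I by (auto simp: directed_index_def)
    then have "hom_le (u k) g" "hom_le (u k) h" "u k \<in> u ` I"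
      using u ij by (auto simp: net_decreases_to_def)
    then show ?thesis unfolding hom_le_def by blast
  qed
  have INF_add: "(INF g\<in>u ` I. g (x + y)) = (INF g\<in>u ` I. g x) + (INF g\<in>u ` I. g y)"
    if "0 \<le> x" "0 \<le> y" for x y
    using ne add pos dir that by (rule cINF_add_directed)
  obtain T where T: "Modules.additive T" "\<And>x. 0 \<le> x \<Longrightarrow> T x = (INF g\<in>u ` I. g x)"
    using additive_extend_pos_cone[of "\<lambda>x. INF g\<in>u ` I. g x", OF INF_add] by blast
  have T_pos: "0 \<le> T x" if "0 \<le> x" for x
    unfolding T(2)[OF that] using ne pos that by (intro cINF_greatest) auto
  have "T x \<le> u i x" if "0 \<le> x" "i \<in> I" for x i
    unfolding T(2)[OF that(1)]
    using pos that by (intro cINF_lower bdd_belowI[of _ 0]) auto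
  then have "\<forall>i\<in>I. hom_le T (u i)" by (simp add: hom_le_def)
  then have "hom_le T (\<lambda>_. 0)"
    using u additive_pos_in_Hom_b[OF T(1) T_pos] by (simp add: net_decreases_to_def)
  then have le0: "(INF g\<in>u ` I. g s) \<le> 0"
    using T(2) s by (auto simp: hom_le_def)
  have "w \<le> 0" if "\<forall>i\<in>I. w \<le> u i s" for w
  proof -
    have "w \<le> (INF g\<in>u ` I. g s)" using that ne by (intro cINF_greatest) auto
    then show ?thesis using le0 by (rule order_trans)
  qed
  then show ?thesis
    using u s unfolding net_decreases_to_def hom_le_def by auto
qed

section \<open>Bounded sets in locally solid f-rings\<close>

lemma zero_nbhd_solidE:
  fixes W :: "'a :: locally_solid_l_ring set"
  assumes "zero_nbhd W"
  obtains S where "zero_nbhd S" "S \<subseteq> W" "solid S"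
proof -
  obtain S V where "S \<subseteq> interior W" "solid S" "V \<subseteq> S" "open V" "0 \<in> V"
    using locally_solid[of "interior W"] assms unfolding zero_nbhd_def by auto
  then show ?thesis
    using that[of S] interior_subset[of W] by (auto simp: zero_nbhd_def interior_def)
qed

lemma solidD: "solid S \<Longrightarrow> y \<in> S \<Longrightarrow> \<bar>x\<bar> \<le> \<bar>y\<bar> \<Longrightarrow> x \<in> S"
  unfolding solid_def by blast

lemma abs_diff_disjoint:
  fixes a b :: "'a :: lattice_ab_group_add_abs"
  assumes "inf a b = 0"
  shows "\<bar>a - b\<bar> = a + b"
proof -
  have "sup a b = a + b"
    using add_eq_inf_sup[of a b] assms by simp
  then have "pprt (a - b) = a"
    using add_sup_distrib_right[of a b "- b"] by (simp add: pprt_def)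
  moreover have "nprt (a - b) = - b"
    using add_inf_distrib_right[of a b "- b"] assms by (simp add: nprt_def)
  ultimately show ?thesis
    using abs_prts[of "a - b"] by simp
qed

text \<open>
  Multiplication by \<open>c\<close> keeps \<open>x\<^sup>+\<close> and \<open>x\<^sup>-\<close> disjoint, so \<open>c x = c x\<^sup>+ - c x\<^sup>-\<close> is the
  decomposition of \<open>c x\<close> into its positive and negative parts.
\<close>

lemma f_ring_abs_mult_pos:
  fixes c x :: "'a :: locally_solid_f_ring"
  assumes "0 \<le> c"
  shows "\<bar>c * x\<bar> = c * \<bar>x\<bar>" and "\<bar>x * c\<bar> = \<bar>x\<bar> * c"
proof -
  have x: "x = pprt x - (- nprt x)" "\<bar>x\<bar> = pprt x + - nprt x"
    using prts[of x] abs_prts[of x] by simp_all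
  have disj: "inf (pprt x) (- nprt x) = 0"
  proof -
    have "pprt x = x + - nprt x"
      using prts[of x] by (metis add_diff_cancel_right' diff_conv_add_uminus)
    then have "inf (pprt x) (- nprt x) = inf (x + - nprt x) (0 + - nprt x)" by simp
    also have "\<dots> = inf x 0 + - nprt x" by (rule add_inf_distrib_right[symmetric])
    finally show ?thesis by (simp only: nprt_def add.right_inverse)
  qed
  have "inf (c * pprt x) (c * (- nprt x)) = 0 \<and> inf (pprt x * c) (- nprt x * c) = 0"
  proof (cases "c = 0")
    case False
    with assms have c: "0 < c" by simp
    have "inf (- nprt x) (c * pprt x) = 0" "inf (- nprt x) (pprt x * c) = 0"
      using f_ring[OF disj c] by (simp_all add: inf.commute)
    then show ?thesis using f_ring[OF _ c] by (metis inf.commute)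
  qed simp
  then have "\<bar>c * pprt x - c * (- nprt x)\<bar> = c * pprt x + c * (- nprt x)"
      "\<bar>pprt x * c - (- nprt x) * c\<bar> = pprt x * c + (- nprt x) * c"
    by (simp_all only: abs_diff_disjoint)
  then show "\<bar>c * x\<bar> = c * \<bar>x\<bar>" "\<bar>x * c\<bar> = \<bar>x\<bar> * c"
    by (metis x right_diff_distrib distrib_left, metis x left_diff_distrib distrib_right)
qed

text \<open>
  The product \<open>v \<bar>b\<bar>\<close> is dominated by \<open>\<bar>v\<bar> \<bar>b\<bar>\<close>, which is \<open>\<bar>\<bar>v\<bar> b\<bar>\<close>. So the
  boundedness of \<open>B\<close> is applied to \<open>\<bar>v\<bar>\<close> instead of \<open>v\<close>, and \<open>\<bar>v\<bar>\<close> is as small as \<open>v\<close>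
  when \<open>v\<close> is taken from a solid neighbourhood.
\<close>

lemma ring_bounded_abs:
  fixes B :: "'a :: locally_solid_f_ring set"
  assumes "ring_bounded B"
  shows "ring_bounded (abs ` B)"
  unfolding ring_bounded_def
proof (intro allI impI)
  fix W :: "'a set" assume "zero_nbhd W"
  then obtain S where S: "zero_nbhd S" "S \<subseteq> W" "solid S" by (rule zero_nbhd_solidE)
  obtain V where V: "zero_nbhd V" "\<forall>v\<in>V. \<forall>b\<in>B. v * b \<in> S \<and> b * v \<in> S"
    using assms[unfolded ring_bounded_def, rule_format, OF S(1)] by (elim exE conjE)
  obtain V' where V': "zero_nbhd V'" "V' \<subseteq> V" "solid V'" using V(1) by (rule zero_nbhd_solidE)
  have "v * \<bar>b\<bar> \<in> S \<and> \<bar>b\<bar> * v \<in> S" if "v \<in> V'" "b \<in> B" for v b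
  proof
    have "\<bar>v\<bar> \<in> V" using solidD[OF V'(3) that(1), of "\<bar>v\<bar>"] V'(2) by auto
    then have S': "\<bar>v\<bar> * b \<in> S" "b * \<bar>v\<bar> \<in> S" using V(2) that(2) by auto
    have "\<bar>v * \<bar>b\<bar>\<bar> \<le> \<bar>\<bar>v\<bar> * b\<bar>" "\<bar>\<bar>b\<bar> * v\<bar> \<le> \<bar>b * \<bar>v\<bar>\<bar>"
      using abs_le_mult[of v "\<bar>b\<bar>"] abs_le_mult[of "\<bar>b\<bar>" v] by (simp_all add: f_ring_abs_mult_pos)
    then show "v * \<bar>b\<bar> \<in> S" "\<bar>b\<bar> * v \<in> S" using solidD[OF S(3)] S' by blast+
  qed
  then show "\<exists>V. zero_nbhd V \<and> (\<forall>v\<in>V. \<forall>b\<in>abs ` B. v * b \<in> W \<and> b * v \<in> W)"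
    using V'(1) S(2) by blast
qed

text \<open>
  The absolute values themselves need not form a directed set; passing to finite suprema
  makes the Levi property applicable, and the AM-property keeps the set bounded.
\<close>

lemma ring_bounded_imp_abs_bounded:
  fixes B :: "'a :: locally_solid_f_ring set"
  assumes AM: "AM_property TYPE('a)" and Levi: "Levi_property TYPE('a)"
    and B: "ring_bounded B"
  obtains s where "0 \<le> s" "\<And>b. b \<in> B \<Longrightarrow> \<bar>b\<bar> \<le> s"
proof (cases "B = {}")
  case False
  define D where "D = finite_sups (abs ` B)"
  have abs_in_D: "\<bar>b\<bar> \<in> D" if "b \<in> B" for b
    unfolding D_def finite_sups_def using that by (intro CollectI exI[of _ "{\<bar>b\<bar>}"]) auto
  have "D \<noteq> {}" using False abs_in_D by blast
  moreover have "\<exists>z\<in>D. x \<le> z \<and> y \<le> z" if xy: "x \<in> D" "y \<in> D" for x y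
  proof -
    from xy obtain F G where FG: "x = Sup_fin F" "y = Sup_fin G" "F \<subseteq> abs ` B" "G \<subseteq> abs ` B"
        "finite F" "finite G" "F \<noteq> {}" "G \<noteq> {}"
      unfolding D_def finite_sups_def by blast
    then have "Sup_fin (F \<union> G) \<in> D"
      unfolding D_def finite_sups_def by (intro CollectI exI[of _ "F \<union> G"]) auto
    moreover have "x \<le> Sup_fin (F \<union> G)" "y \<le> Sup_fin (F \<union> G)"
      using FG by (auto intro: Sup_fin.subset_imp)
    ultimately show ?thesis by blast
  qed
  moreover have "0 \<le> x" if "x \<in> D" for x
  proof -
    from that obtain F where F: "x = Sup_fin F" "F \<subseteq> abs ` B" "finite F" "F \<noteq> {}"
      unfolding D_def finite_sups_def by blast
    then obtain b where b: "\<bar>b\<bar> \<in> F" by blast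
    have "0 \<le> \<bar>b\<bar>" by simp
    also have "\<bar>b\<bar> \<le> x" using Sup_fin.coboundedI[OF F(3) b] F(1) by simp
    finally show ?thesis .
  qed
  moreover have "ring_bounded D"
    using AM ring_bounded_abs[OF B] unfolding AM_property_def D_def by blast
  ultimately obtain s where s: "\<forall>x\<in>D. x \<le> s"
    using Levi[unfolded Levi_property_def, rule_format, of D] by blast
  have "\<bar>b\<bar> \<le> s" if "b \<in> B" for b using s abs_in_D[OF that] by blast
  moreover from this have "0 \<le> s" using False abs_ge_zero order_trans by blast
  ultimately show ?thesis by (intro that)
qed (use that[of 0] in auto)

section \<open>The Lebesgue property of the homomorphism space\<close>

theorem theorem5:
  assumes "singletons_group_bounded TYPE('a :: locally_solid_f_ring)"
    and "singletons_group_bounded TYPE('b :: {locally_solid_f_ring, conditionally_complete_lattice})"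
    and "AM_property TYPE('a)"
    and "Levi_property TYPE('a)"
    and "Lebesgue_property TYPE('b) (euclidean :: 'b topology) (\<le>) 0"
  shows "Lebesgue_property TYPE('i) (hom_topology :: ('a \<Rightarrow> 'b) topology) hom_le (\<lambda>_. 0)"
  unfolding Lebesgue_property_def topspace_hom_topology limitin_hom_topology
proof (intro allI impI conjI; elim conjE)
  fix I :: "'i set" and r and u :: "'i \<Rightarrow> 'a \<Rightarrow> 'b"
  assume I: "directed_index I r" and u: "net_decreases_to Hom_b hom_le I r u (\<lambda>_. 0)"
  show "(\<lambda>_. 0 :: 'b) \<in> (Hom_b :: ('a \<Rightarrow> 'b) set)"
    using u by (simp add: net_decreases_to_def)
  fix B :: "'a set" and V :: "'b set"
  assume B: "ring_bounded B" and V: "zero_nbhd V"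
  obtain s where s: "0 \<le> s" "\<And>b. b \<in> B \<Longrightarrow> \<bar>b\<bar> \<le> s"
    using ring_bounded_imp_abs_bounded[OF assms(3,4) B] by blast
  obtain S where S: "zero_nbhd S" "S \<subseteq> V" "solid S" using V by (rule zero_nbhd_solidE)
  have "Lebesgue_property TYPE('i) (euclidean :: 'b topology) (\<le>) 0"
    using assms(5) by (rule Lebesgue_property_any_index) (auto intro!: reflp_onI transp_onI)
  then have "limitin euclidean (\<lambda>i. u i s) 0 (net_filter I r)"
    using I net_decreases_to_0_pointwise[OF I u s(1)] unfolding Lebesgue_property_def by simp
  then have "eventually (\<lambda>i. u i s \<in> interior S) (net_filter I r)"
    using S(1) by (simp add: limitin_def zero_nbhd_def)
  then obtain i where i: "i \<in> I" "\<forall>j\<in>I. r i j \<longrightarrow> u j s \<in> interior S"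
    unfolding eventually_net_filter[OF I] by blast
  have "u j \<in> Hom_b \<and> (\<forall>x\<in>B. u j x - 0 \<in> V)" if j: "j \<in> I" "r i j" for j
  proof (intro conjI ballI)
    show Hom: "u j \<in> Hom_b" using u j(1) by (auto simp: net_decreases_to_def)
    have pos: "0 \<le> u j x" if "0 \<le> x" for x
      using u j(1) that by (simp add: net_decreases_to_def hom_le_def)
    fix x assume "x \<in> B"
    then have "\<bar>u j x\<bar> \<le> \<bar>u j s\<bar>"
      using additive_pos_abs_le[of "u j" x s] Hom pos s by (simp add: Hom_b_def)
    moreover have "u j s \<in> S" using i(2) j interior_subset by blast
    ultimately show "u j x - 0 \<in> V" using solidD[OF S(3)] S(2) by auto
  qed
  then show "eventually (\<lambda>i. u i \<in> Hom_b \<and> (\<forall>x\<in>B. u i x - 0 \<in> V)) (net_filter I r)"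
    unfolding eventually_net_filter[OF I] using i(1) by blast
qed

end
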